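(* For any set $\mathbf P$ of path axioms and any nested sequent $\Gamma$, $\Gamma$ is derivable in $\mathbf{SKt}+\mathbf P$ if and only if $\Gamma$ is derivable in $\mathbf{DKt}+\mathbf P$.
   Context: Formulae are in negation normal form over $a,\neg a,\lor,\land,\square,\blacksquare,\lozenge,\lozenge^{\bullet}$, where $\lozenge^{\bullet}$ is the past diamond (dual of $\blacksquare$). Nested sequents are multisets of formulae and structures $\circ\{\Gamma\}$, $\bullet\{\Delta\}$; $\Sigma[\,]$ is a context with holes at any depth. $\mathbf{SKt}$: $id$ ($\Gamma,a,\overline a$), $cut$, $\land$, $\lor$, $ctr$, $wk$, $rf$ (from $\Gamma,\circ\{\Delta\}$ infer $\bullet\{\Gamma\},\Delta$), $rp$ (from $\Gamma,\bullet\{\Delta\}$ infer $\circ\{\Gamma\},\Delta$), $\blacksquare$ (from $\Gamma,\bullet\{A\}$ infer $\Gamma,\blacksquare A$), $\square$ (from $\Gamma,\circ\{A\}$ infer $\Gamma,\square A$), $\lozenge^{\bullet}$ (from $\Gamma,\bullet\{\Delta,A\}$ infer $\Gamma,\bullet\{\Delta\},\lozenge^{\bullet}A$), $\lozenge$ (from $\Gamma,\circ\{\Delta,A\}$ infer $\Gamma,\circ\{\Delta\},\lozenge A$). A path axiom is a scheme $\langle?\rangle_1\cdots\langle?\rangle_n X\to\langle?\rangle X$ ($n\ge0$, each diamond $\lozenge$ or $\lozenge^{\bullet}$). $\mathbf{SKt}+\mathbf P$ adds for each axiom in $\mathbf P$ the structural rule: from $\Gamma,\star\{\Delta\}$ infer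 $\Gamma,\star_1\{\cdots\star_n\{\Delta\}\cdots\}$ ($\star$ is $\circ$ for $\lozenge$, $\bullet$ for $\lozenge^{\bullet}$). $\mathbf{DKt}$: $id$: $\Sigma[a,\overline a]$; $\land$: from $\Sigma[A\land B,A]$, $\Sigma[A\land B,B]$ infer $\Sigma[A\land B]$; $\lor$: from $\Sigma[A\lor B,A,B]$ infer $\Sigma[A\lor B]$; $\blacksquare$: from $\Sigma[\blacksquare A,\bullet\{A\}]$ infer $\Sigma[\blacksquare A]$; $\square$: from $\Sigma[\square A,\circ\{A\}]$ infer $\Sigma[\square A]$; $\lozenge^{\bullet}_1$: from $\Sigma[\bullet\{\Delta,A\},\lozenge^{\bullet}A]$ infer $\Sigma[\bullet\{\Delta\},\lozenge^{\bullet}A]$; $\lozenge^{\bullet}_2$: from $\Sigma[\circ\{\Delta,\lozenge^{\bullet}A\},A]$ infer $\Sigma[\circ\{\Delta,\lozenge^{\bullet}A\}]$; $\lozenge_1$: from $\Sigma[\circ\{\Delta,A\},\lozenge A]$ infer $\Sigma[\circ\{\Delta\},\lozenge A]$; $\lozenge_2$: from $\Sigma[\bullet\{\Delta,\lozenge A\},A]$ infer $\Sigma[\bullet\{\Delta,\lozenge A\}]$. For $\langle?\rangle\in\{\lozenge,\lozenge^{\bullet}\}$ let $\langle?\rangle^{-1}$ be the other one. The inverted version $I(F)$ of $F=\langle?\rangle_1\cdots\langle?\rangle_n X\to\langle?\rangle X$ is $\langle?\rangle_n^{-1}\cdots\langle?\rangle_1^{-1}X\to\langle?\rangle^{-1}X$.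 If $F=\langle?\rangle_{F_1}\cdots\langle?\rangle_{F_m}X\to\langle?\rangle_F X$ and $G=\langle?\rangle_{G_1}\cdots\langle?\rangle_{G_n}X\to\langle?\rangle_G X$ with $\langle?\rangle_F=\langle?\rangle_{G_i}$, their composition at $i$ is $\langle?\rangle_{G_1}\cdots\langle?\rangle_{G_{i-1}}\langle?\rangle_{F_1}\cdots\langle?\rangle_{F_m}\langle?\rangle_{G_{i+1}}\cdots\langle?\rangle_{G_n}X\to\langle?\rangle_G X$. The completion $\mathbf Q^*$ of a set $\mathbf Q$ is the smallest superset containing $\lozenge X\to\lozenge X$ and $\lozenge^{\bullet}X\to\lozenge^{\bullet}X$ and closed under all compositions. For a nested sequent, view it as a tree whose nodes are multisets of formulae and whose edges are labelled $\circ$ or $\bullet$; its propagation graph has the same nodes and, for each $\circ$-child $n_1$ of $n$, an edge $n\to n_1$ labelled $\lozenge$ and $n_1\to n$ labelled $\lozenge^{\bullet}$, and for each $\bullet$-child $n_1$ of $n$, an edge $n\to n_1$ labelled $\lozenge^{\bullet}$ and $n_1\to n$ labelled $\lozenge$. $\mathbf{DKt}+\mathbf P$ is $\mathbf{DKt}$ plus all propagation rules: from $\Sigma[\langle?\rangle A]_i[A]_j$ infer $\Sigma[\langle?\rangle A]_i[\emptyset]_j$ (holes at nodes $i$ and $j$), whenever there is a path from $i$ to $j$ in the propagation graph whose sequence of labels $s$ satisfies $sX\to\langle?\rangle X\in(\mathbf P\cup I(\mathbf P))^*$. *)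

theory Defs
  imports Main "HOL-Library.Multiset"
begin

text \<open>
  The two tense directions. \<^term>\<open>White\<close> indexes the box, the diamond and the structural connective
  \<open>\<circ>{_}\<close>; \<^term>\<open>Black\<close> indexes the past box, the past diamond and \<open>\<bullet>{_}\<close>. Indexing by the direction
  turns each pair of mirror-image rules (such as rf and rp) into a single one.
\<close>

datatype dir = White | Black

fun dual_dir :: "dir \<Rightarrow> dir" where
  "dual_dir White = Black"
| "dual_dir Black = White"

datatype 'a fm =
    Atom 'a
  | NAtom 'a
  | Or "'a fm" "'a fm"
  | And "'a fm" "'a fm"
  | Box dir "'a fm"
  | Dia dir "'a fm"

primrec neg :: "'a fm \<Rightarrow> 'a fm" where
  "neg (Atom a) = NAtom a"
| "neg (NAtom a) = Atom a"
| "neg (Or A B) = And (neg A) (neg B)"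
| "neg (And A B) = Or (neg A) (neg B)"
| "neg (Box d A) = Dia d (neg A)"
| "neg (Dia d A) = Box d (neg A)"

text \<open>\<^term>\<open>St White \<Gamma>\<close> is \<open>\<circ>{\<Gamma>}\<close> and \<^term>\<open>St Black \<Gamma>\<close> is \<open>\<bullet>{\<Gamma>}\<close>.\<close>

datatype 'a elem = Fm "'a fm" | St dir "'a elem multiset"

type_synonym 'a nseq = "'a elem multiset"

text \<open>
  The pair \<open>([d\<^sub>1, \<dots>, d\<^sub>n], d)\<close> stands for the path axiom scheme
  \<open>\<langle>?\<rangle>\<^sub>1 \<cdots> \<langle>?\<rangle>\<^sub>n X \<rightarrow> \<langle>?\<rangle> X\<close>, each diamond being given by its direction.
\<close>

type_synonym path_axiom = "dir list \<times> dir"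

fun nest :: "dir list \<Rightarrow> 'a nseq \<Rightarrow> 'a nseq" where
  "nest [] \<Delta> = \<Delta>"
| "nest (d # ds) \<Delta> = {#St d (nest ds \<Delta>)#}"

inductive SKt :: "path_axiom set \<Rightarrow> 'a nseq \<Rightarrow> bool" for P :: "path_axiom set" where
  id: "SKt P (\<Gamma> + {#Fm (Atom a), Fm (NAtom a)#})"
| cut: "SKt P (\<Gamma> + {#Fm A#}) \<Longrightarrow> SKt P (\<Delta> + {#Fm (neg A)#}) \<Longrightarrow> SKt P (\<Gamma> + \<Delta>)"
| conj: "SKt P (\<Gamma> + {#Fm A#}) \<Longrightarrow> SKt P (\<Gamma> + {#Fm B#}) \<Longrightarrow> SKt P (\<Gamma> + {#Fm (And A B)#})"
| disj: "SKt P (\<Gamma> + {#Fm A, Fm B#}) \<Longrightarrow> SKt P (\<Gamma> + {#Fm (Or A B)#})"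
| ctr: "SKt P (\<Gamma> + \<Delta> + \<Delta>) \<Longrightarrow> SKt P (\<Gamma> + \<Delta>)"
| wk: "SKt P \<Gamma> \<Longrightarrow> SKt P (\<Gamma> + \<Delta>)"
| residuation: "SKt P (\<Gamma> + {#St d \<Delta>#}) \<Longrightarrow> SKt P ({#St (dual_dir d) \<Gamma>#} + \<Delta>)"
| box: "SKt P (\<Gamma> + {#St d {#Fm A#}#}) \<Longrightarrow> SKt P (\<Gamma> + {#Fm (Box d A)#})"
| dia: "SKt P (\<Gamma> + {#St d (\<Delta> + {#Fm A#})#}) \<Longrightarrow> SKt P (\<Gamma> + {#St d \<Delta>, Fm (Dia d A)#})"
| path_rule: "(ds, d) \<in> P \<Longrightarrow> SKt P (\<Gamma> + {#St d \<Delta>#}) \<Longrightarrow> SKt P (\<Gamma> + nest ds \<Delta>)"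

text \<open>Contexts with one hole, at any depth.\<close>

datatype 'a ctx = Hole "'a nseq" | Under "'a nseq" dir "'a ctx"

primrec fill :: "'a ctx \<Rightarrow> 'a nseq \<Rightarrow> 'a nseq" where
  "fill (Hole \<Gamma>) \<Delta> = \<Gamma> + \<Delta>"
| "fill (Under \<Gamma> d S) \<Delta> = \<Gamma> + {#St d (fill S \<Delta>)#}"

fun invert :: "path_axiom \<Rightarrow> path_axiom" where
  "invert (ds, d) = (rev (map dual_dir ds), dual_dir d)"

inductive_set completion :: "path_axiom set \<Rightarrow> path_axiom set" for Q :: "path_axiom set" where
  base: "F \<in> Q \<Longrightarrow> F \<in> completion Q"
| ident: "([d], d) \<in> completion Q"
| compose: "(fs, f) \<in> completion Q \<Longrightarrow> (gs @ f # gs', g) \<in> completion Q \<Longrightarrow>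
    (gs @ fs @ gs', g) \<in> completion Q"

text \<open>
  Identical substructures of a nested sequent are not distinguished by the multiset, so to speak of
  its nodes we use a tree whose children are listed in some order. Every nested sequent is
  \<open>nseq_of t\<close> for some tree \<open>t\<close>, unique up to the order of siblings. A node is the list of child
  indices leading to it from the root.
\<close>

datatype 'a tree = Node "'a fm multiset" "(dir \<times> 'a tree) list"

fun nseq_of :: "'a tree \<Rightarrow> 'a nseq" where
  "nseq_of (Node M ts) = image_mset Fm M + mset (map (\<lambda>(d, t). St d (nseq_of t)) ts)"

fun edge_labels :: "'a tree \<Rightarrow> dir list" where
  "edge_labels (Node M ts) = map fst ts"

inductive subtree_at :: "'a tree \<Rightarrow> nat list \<Rightarrow> 'a tree \<Rightarrow> bool" where
  root: "subtree_at t [] t"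
| child: "k < length ts \<Longrightarrow> subtree_at (snd (ts ! k)) p u \<Longrightarrow> subtree_at (Node M ts) (k # p) u"

definition nodes :: "'a tree \<Rightarrow> nat list set" where
  "nodes t = {p. \<exists>u. subtree_at t p u}"

fun put :: "nat list \<Rightarrow> 'a fm \<Rightarrow> 'a tree \<Rightarrow> 'a tree" where
  "put [] A (Node M ts) = Node (M + {#A#}) ts"
| "put (k # p) A (Node M ts) =
    (if k < length ts then Node M (ts[k := (fst (ts ! k), put p A (snd (ts ! k)))]) else Node M ts)"

text \<open>
  The labelled edges of the propagation graph: \<open>(i, d, j)\<close> is an edge from \<open>i\<close> to \<open>j\<close> labelled with
  the diamond of direction \<open>d\<close>.
\<close>

inductive_set prop_graph :: "'a tree \<Rightarrow> (nat list \<times> dir \<times> nat list) set" for t :: "'a tree" where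
  down: "subtree_at t p u \<Longrightarrow> k < length (edge_labels u) \<Longrightarrow>
    (p, edge_labels u ! k, p @ [k]) \<in> prop_graph t"
| up: "subtree_at t p u \<Longrightarrow> k < length (edge_labels u) \<Longrightarrow>
    (p @ [k], dual_dir (edge_labels u ! k), p) \<in> prop_graph t"

inductive graph_path :: "('n \<times> 'l \<times> 'n) set \<Rightarrow> 'n \<Rightarrow> 'l list \<Rightarrow> 'n \<Rightarrow> bool"
  for G :: "('n \<times> 'l \<times> 'n) set" where
  empty: "graph_path G i [] i"
| step: "(i, l, k) \<in> G \<Longrightarrow> graph_path G k s j \<Longrightarrow> graph_path G i (l # s) j"

text \<open>
  In the rule \<open>propagate\<close>, the two-hole context is the tree \<open>t\<close> with the nodes \<open>i\<close> and \<open>j\<close>, which may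
  coincide; filling holes with formulae does not affect the propagation graph.
\<close>

inductive DKt :: "path_axiom set \<Rightarrow> 'a nseq \<Rightarrow> bool" for P :: "path_axiom set" where
  id: "DKt P (fill S {#Fm (Atom a), Fm (NAtom a)#})"
| conj: "DKt P (fill S {#Fm (And A B), Fm A#}) \<Longrightarrow> DKt P (fill S {#Fm (And A B), Fm B#}) \<Longrightarrow>
    DKt P (fill S {#Fm (And A B)#})"
| disj: "DKt P (fill S {#Fm (Or A B), Fm A, Fm B#}) \<Longrightarrow> DKt P (fill S {#Fm (Or A B)#})"
| box: "DKt P (fill S {#Fm (Box d A), St d {#Fm A#}#}) \<Longrightarrow> DKt P (fill S {#Fm (Box d A)#})"
| dia1: "DKt P (fill S {#St d (\<Delta> + {#Fm A#}), Fm (Dia d A)#}) \<Longrightarrow>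
    DKt P (fill S {#St d \<Delta>, Fm (Dia d A)#})"
| dia2: "DKt P (fill S {#St (dual_dir d) (\<Delta> + {#Fm (Dia d A)#}), Fm A#}) \<Longrightarrow>
    DKt P (fill S {#St (dual_dir d) (\<Delta> + {#Fm (Dia d A)#})#})"
| propagate: "i \<in> nodes t \<Longrightarrow> j \<in> nodes t \<Longrightarrow> graph_path (prop_graph t) i s j \<Longrightarrow>
    (s, d) \<in> completion (P \<union> invert ` P) \<Longrightarrow>
    DKt P (nseq_of (put i (Dia d A) (put j A t))) \<Longrightarrow> DKt P (nseq_of (put i (Dia d A) t))"

end

theory Submission
  imports Defs
begin

text \<open>
  A rule of DKt becomes a shallow rule of SKt once its principal node is displayed. A propagation
  rule is obtained by moving \<open>A\<close> backwards along the path, each edge prefixing a diamond, and cutting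
  the resulting \<open>\<langle>?\<rangle>\<^sub>1 \<cdots> \<langle>?\<rangle>\<^sub>n A\<close> with the derivable \<open>\<langle>?\<rangle>\<^sub>1 \<cdots> \<langle>?\<rangle>\<^sub>n A \<rightarrow> \<langle>?\<rangle> A\<close>.

  For the converse no cut is eliminated. SKt is sound for the Kripke frames in which every axiom
  of \<open>P\<close> holds, so it suffices to refute in such a frame every sequent underivable in DKt. Bottom-up
  proof search gives an infinite chain of underivable trees whose union is saturated; its nodes are
  the worlds, and \<open>R d x y\<close> holds if a path from \<open>x\<close> to \<open>y\<close> in the propagation graph has labels \<open>s\<close>
  with \<open>(s, d)\<close> in the completion. Closure of the completion under composition and inversion makes
  this a frame of the required kind, and the propagation rules are exactly what the truth lemma needs
  for diamonds.
\<close>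

section \<open>Trees\<close>

lemma dual_dual [simp]: "dual_dir (dual_dir d) = d"
  by (cases d) auto

inductive_simps subtree_at_Nil [simp]: "subtree_at t [] u"
inductive_simps subtree_at_Cons [simp]: "subtree_at (Node M ts) (k # p) u"

text \<open>List update ignores an index out of range, so the unspecified \<open>ts ! k\<close> has
  no effect on an invalid address.\<close>

fun repl :: "nat list \<Rightarrow> 'a tree \<Rightarrow> 'a tree \<Rightarrow> 'a tree" where
  "repl [] u t = u"
| "repl (k # p) u (Node M ts) = Node M (ts[k := (fst (ts ! k), repl p u (snd (ts ! k)))])"

lemma subtree_at_fun: "subtree_at t p u \<Longrightarrow> subtree_at t p v \<Longrightarrow> u = v"
proof (induction arbitrary: v rule: subtree_at.induct)
  case (child k ts p u M)
  then show ?case by simp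
qed simp

lemma subtree_at_append: "subtree_at t p u \<Longrightarrow> subtree_at u q v \<Longrightarrow> subtree_at t (p @ q) v"
  by (induction rule: subtree_at.induct) (auto intro: subtree_at.child)

lemma subtree_at_repl: "subtree_at t p u \<Longrightarrow> subtree_at (repl p v t) p v"
  by (induction rule: subtree_at.induct) auto

lemma put_eq_repl: "subtree_at t p u \<Longrightarrow> put p A t = repl p (put [] A u) t"
  by (induction rule: subtree_at.induct) auto

lemma put_append: "subtree_at t p u \<Longrightarrow> put (p @ q) A t = repl p (put q A u) t"
  by (induction rule: subtree_at.induct) auto

text \<open>In \<open>propagate\<close> the principal diamond is put in last; commuting lets the
  propagated formula be treated as the new one.\<close>

lemma put_commute: "put p A (put q B t) = put q B (put p A t)"
proof (induction p A t arbitrary: q rule: put.induct)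
  case (1 A M ts)
  then show ?case by (cases q) auto
next
  case (2 k p A M ts)
  show ?case
  proof (cases q)
    case (Cons m r)
    with 2 show ?thesis by (cases "m = k") (auto simp: list_update_swap)
  qed simp
qed

text \<open>Only formulae are added, never nodes or edges. This carries nodes and paths back to the
  tree before the insertion.\<close>

lemma put_subtree_labels:
  "subtree_at (put p A t) q v \<Longrightarrow> \<exists>u. subtree_at t q u \<and> edge_labels u = edge_labels v"
proof (induction p A t arbitrary: q rule: put.induct)
  case (1 A M ts)
  then show ?case by (cases q) auto
next
  case (2 k p A M ts)
  show ?case
  proof (cases "k < length ts")
    case True
    show ?thesis
    proof (cases q)
      case Nil
      with 2 True show ?thesis
        by (auto simp: map_update) (metis list_update_id length_map nth_map)
    next
      case (Cons m r)
      with 2 True show ?thesis by (cases "m = k") auto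
    qed
  next
    case False
    with 2 show ?thesis by auto
  qed
qed

lemma nodes_put: "nodes (put p A t) \<subseteq> nodes t"
  unfolding nodes_def using put_subtree_labels by blast

lemma prop_graph_put: "prop_graph (put p A t) \<subseteq> prop_graph t"
proof clarify
  fix q d r assume "(q, d, r) \<in> prop_graph (put p A t)"
  then show "(q, d, r) \<in> prop_graph t"
  proof (cases rule: prop_graph.cases)
    case (down v k)
    with put_subtree_labels[OF down(3)] show ?thesis using prop_graph.down by metis
  next
    case (up v k)
    with put_subtree_labels[OF up(3)] show ?thesis using prop_graph.up by metis
  qed
qed

lemma prop_graph_sym: "(p, d, q) \<in> prop_graph t \<Longrightarrow> (q, dual_dir d, p) \<in> prop_graph t"
  by (erule prop_graph.cases) (auto intro: prop_graph.intros)

lemma prop_graph_target: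
  assumes "(p, d, q) \<in> prop_graph t"
  shows "q \<in> nodes t"
  using assms
proof (cases rule: prop_graph.cases)
  case (down u k)
  have "\<exists>v. subtree_at u [k] v" using down by (cases u) auto
  with down show ?thesis unfolding nodes_def using subtree_at_append by blast
qed (auto simp: nodes_def)

lemma nodesE:
  assumes "p \<in> nodes t"
  obtains M ts where "subtree_at t p (Node M ts)"
proof -
  from assms obtain u where "subtree_at t p u" unfolding nodes_def by blast
  with that show ?thesis by (cases u) auto
qed

lemma finite_nodes: "finite (nodes t)"
proof (induction t)
  case (Node M ts)
  have "nodes (Node M ts) \<subseteq> insert [] (\<Union>k<length ts. (#) k ` nodes (snd (ts ! k)))"
  proof
    fix p assume "p \<in> nodes (Node M ts)"
    then show "p \<in> insert [] (\<Union>k<length ts. (#) k ` nodes (snd (ts ! k)))"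
      by (cases p) (fastforce simp: nodes_def)+
  qed
  moreover have "finite (nodes (snd (ts ! k)))" if "k < length ts" for k
    using Node that by (metis nth_mem prod.collapse snds.intros)
  ultimately show ?case
    by (meson finite.insertI finite_UN_I finite_imageI finite_lessThan finite_subset lessThan_iff)
qed

text \<open>The recursion of \<open>elem\<close> passes through multisets, so the induction is on
  one element. Fact \<open>*\<close> then lists the members of a multiset one at a time, formulae
  into the root label and structures into the list of children.\<close>

lemma ex_tree: "\<exists>t. nseq_of t = \<Gamma>"
proof -
  have *: "\<exists>t. nseq_of t = \<Delta>"
    if "\<And>d \<Delta>'. St d \<Delta>' \<in># \<Delta> \<Longrightarrow> \<exists>t. nseq_of t = \<Delta>'" for \<Delta> :: "'a nseq"
    using that
  proof (induction \<Delta>)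
    case empty
    have "nseq_of (Node {#} []) = {#}" by simp
    then show ?case by blast
  next
    case (add e \<Delta>)
    then obtain M ts where t: "nseq_of (Node M ts) = \<Delta>"
      by (metis nseq_of.cases union_single_eq_member add_mset_add_single union_iff)
    show ?case
    proof (cases e)
      case (Fm A)
      with t have "nseq_of (Node (add_mset A M) ts) = add_mset e \<Delta>" by simp
      then show ?thesis by blast
    next
      case (St d \<Delta>')
      with add.prems obtain u where "nseq_of u = \<Delta>'" by auto
      with t St have "nseq_of (Node M ((d, u) # ts)) = add_mset e \<Delta>" by simp
      then show ?thesis by blast
    qed
  qed
  have "\<exists>t. nseq_of t = \<Delta>" if "e = St d \<Delta>" for e :: "'a elem" and d \<Delta>
    using that
  proof (induction e arbitrary: d \<Delta>)
    case (St d' \<Delta>')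
    show ?case by (rule *) (use St in auto)
  qed auto
  then show ?thesis by (rule *) blast
qed

section \<open>Addresses in trees and contexts of nested sequents\<close>

text \<open>Material beside the hole is absorbed into the context. One \<open>S'\<close> serves all
  fillings, so premise and conclusion of a rule share it.\<close>

lemma fill_union: "\<exists>S'. \<forall>\<Delta>. fill S (\<Gamma> + \<Delta>) = fill S' \<Delta>"
proof (induction S)
  case (Hole \<Pi>)
  have "\<forall>\<Delta>. fill (Hole \<Pi>) (\<Gamma> + \<Delta>) = fill (Hole (\<Pi> + \<Gamma>)) \<Delta>" by simp
  then show ?case by blast
next
  case (Under \<Pi> d S)
  then obtain S' where "\<forall>\<Delta>. fill S (\<Gamma> + \<Delta>) = fill S' \<Delta>" by blast
  then have "\<forall>\<Delta>. fill (Under \<Pi> d S) (\<Gamma> + \<Delta>) = fill (Under \<Pi> d S') \<Delta>" by simp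
  then show ?case by blast
qed

abbreviation nseq_children :: "(dir \<times> 'a tree) list \<Rightarrow> 'a nseq" where
  "nseq_children ts \<equiv> mset (map (\<lambda>(d, t). St d (nseq_of t)) ts)"

lemma nseq_children_update:
  assumes "k < length ts"
  obtains \<Gamma> where "\<And>d t. nseq_children (ts[k := (d, t)]) = \<Gamma> + {#St d (nseq_of t)#}"
    and "nseq_children ts = \<Gamma> + {#St (fst (ts ! k)) (nseq_of (snd (ts ! k)))#}"
proof
  let ?\<Gamma> = "nseq_children ts - {#St (fst (ts ! k)) (nseq_of (snd (ts ! k)))#}"
  show *: "nseq_children (ts[k := (d, t)]) = ?\<Gamma> + {#St d (nseq_of t)#}" for d t
    using assms by (simp add: map_update mset_update case_prod_beta)
  show "nseq_children ts = ?\<Gamma> + {#St (fst (ts ! k)) (nseq_of (snd (ts ! k)))#}"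
    using *[of "fst (ts ! k)" "snd (ts ! k)"] by simp
qed

text \<open>Translates an address into a context: labels and siblings along the way form
  \<open>S\<close>, and they do not change when the subtree does.\<close>

lemma repl_fill:
  "subtree_at t p u \<Longrightarrow>
    \<exists>S. nseq_of t = fill S (nseq_of u) \<and> (\<forall>v. nseq_of (repl p v t) = fill S (nseq_of v))"
proof (induction rule: subtree_at.induct)
  case (root t)
  have "nseq_of t = fill (Hole {#}) (nseq_of t) \<and>
    (\<forall>v. nseq_of (repl [] v t) = fill (Hole {#}) (nseq_of v))" by simp
  then show ?case by blast
next
  case (child k ts p u M)
  then obtain S where S: "nseq_of (snd (ts ! k)) = fill S (nseq_of u)"
    "\<And>v. nseq_of (repl p v (snd (ts ! k))) = fill S (nseq_of v)" by blast
  obtain \<Gamma> where \<Gamma>: "\<And>d t. nseq_children (ts[k := (d, t)]) = \<Gamma> + {#St d (nseq_of t)#}"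
    "nseq_children ts = \<Gamma> + {#St (fst (ts ! k)) (nseq_of (snd (ts ! k)))#}"
    by (rule nseq_children_update[OF child(1)]) blast
  let ?S = "Under (image_mset Fm M + \<Gamma>) (fst (ts ! k)) S"
  have "nseq_of (Node M ts) = fill ?S (nseq_of u)"
    "\<forall>v. nseq_of (repl (k # p) v (Node M ts)) = fill ?S (nseq_of v)"
    using S by (simp_all add: \<Gamma> del: mset_map)
  then show ?case by blast
qed

text \<open>Brings a node into the shape of a \<open>DKt\<close> rule: \<open>N\<close> is the
  principal part, \<open>M'\<close> and the old children join the context, \<open>N'\<close> and
  \<open>cs\<close> are what a premise adds.\<close>

lemma node_fill:
  assumes "subtree_at t p (Node M ts)" and "M = M' + N"
  obtains S where "nseq_of t = fill S (image_mset Fm N)"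
    and "\<And>N' cs. nseq_of (repl p (Node (M + N') (ts @ cs)) t) =
      fill S (image_mset Fm N + image_mset Fm N' + nseq_children cs)"
proof -
  obtain S where S: "nseq_of t = fill S (nseq_of (Node M ts))"
    "\<forall>v. nseq_of (repl p v t) = fill S (nseq_of v)"
    using repl_fill[OF assms(1)] by blast
  obtain S' where S': "\<And>\<Delta>. fill S ((image_mset Fm M' + nseq_children ts) + \<Delta>) = fill S' \<Delta>"
    using fill_union by blast
  show ?thesis
  proof
    show "nseq_of t = fill S' (image_mset Fm N)"
      using S(1) assms(2) by (simp add: S'[symmetric] union_ac del: mset_map)
    show "nseq_of (repl p (Node (M + N') (ts @ cs)) t) =
        fill S' (image_mset Fm N + image_mset Fm N' + nseq_children cs)" for N' cs
      using S(2) assms(2) by (simp add: S'[symmetric] union_ac del: mset_map)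
  qed
qed

lemma put_fill:
  assumes "p \<in> nodes t"
  obtains S where "\<And>A. nseq_of (put p A t) = fill S {#Fm A#}"
    and "\<And>A B. nseq_of (put p A (put p B t)) = fill S {#Fm A, Fm B#}"
proof -
  obtain M ts where u: "subtree_at t p (Node M ts)"
    using assms by (rule nodesE)
  obtain S where "nseq_of t = fill S (image_mset Fm {#})"
    and S: "\<And>N' cs. nseq_of (repl p (Node (M + N') (ts @ cs)) t) =
      fill S (image_mset Fm {#} + image_mset Fm N' + nseq_children cs)"
    using node_fill[OF u, of M "{#}"] by auto
  have [simp]: "repl p v (repl p w t) = repl p v t" for v w
    using u by (induction t p "Node M ts" rule: subtree_at.induct) auto
  show ?thesis
  proof
    show "nseq_of (put p A t) = fill S {#Fm A#}" for A
      using put_eq_repl[OF u] S[of "{#A#}" "[]"] by simp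
    show "nseq_of (put p A (put p B t)) = fill S {#Fm A, Fm B#}" for A B
    proof -
      have "put p A (put p B t) = repl p (Node (M + {#A, B#}) ts) t"
        using put_eq_repl[OF u, of B] put_eq_repl[OF subtree_at_repl[OF u]] by simp
      then show ?thesis using S[of "{#A, B#}" "[]"] by simp
    qed
  qed
qed

text \<open>The two ends of an edge share one context, with \<open>\<Delta>\<close> the content of
  the child. This is the shape of the diamond rules across that edge.\<close>

lemma edge_fill:
  assumes "subtree_at t p u" and "k < length (edge_labels u)"
  obtains S \<Delta> where
    "\<And>A. nseq_of (put p A t) = fill S {#St (edge_labels u ! k) \<Delta>, Fm A#}"
    and "\<And>A. nseq_of (put (p @ [k]) A t) = fill S {#St (edge_labels u ! k) (\<Delta> + {#Fm A#})#}"
proof -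
  obtain M ts where u: "u = Node M ts" by (cases u)
  with assms have k: "k < length ts" by simp
  obtain \<Gamma> where \<Gamma>: "\<And>d t. nseq_children (ts[k := (d, t)]) = \<Gamma> + {#St d (nseq_of t)#}"
    "nseq_children ts = \<Gamma> + {#St (fst (ts ! k)) (nseq_of (snd (ts ! k)))#}"
    by (rule nseq_children_update[OF k]) blast
  obtain S where S: "\<forall>v. nseq_of (repl p v t) = fill S (nseq_of v)"
    using repl_fill[OF assms(1)] by blast
  obtain S' where S': "\<And>\<Delta>. fill S ((image_mset Fm M + \<Gamma>) + \<Delta>) = fill S' \<Delta>"
    using fill_union by blast
  have [simp]: "nseq_of (put [] A c) = nseq_of c + {#Fm A#}" for A and c :: "'a tree"
    by (cases c) simp
  show ?thesis
  proof
    let ?\<Delta> = "nseq_of (snd (ts ! k))"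
    show "nseq_of (put p A t) = fill S' {#St (edge_labels u ! k) ?\<Delta>, Fm A#}" for A
      using put_eq_repl[OF assms(1)] S u k S'[symmetric] by (simp add: \<Gamma> del: mset_map)
    show "nseq_of (put (p @ [k]) A t) = fill S' {#St (edge_labels u ! k) (?\<Delta> + {#Fm A#})#}" for A
      using put_append[OF assms(1), of "[k]" A] S u k S'[symmetric] by (simp add: \<Gamma> del: mset_map)
  qed
qed

section \<open>Extension of trees\<close>

definition occ :: "'a tree \<Rightarrow> nat list \<Rightarrow> 'a fm \<Rightarrow> bool" where
  "occ t p A \<longleftrightarrow> (\<exists>M ts. subtree_at t p (Node M ts) \<and> A \<in># M)"

text \<open>The old labels form a prefix because new children are appended on the right. Addresses
  therefore keep their meaning along a chain of extensions, and its union makes sense.\<close>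

fun node_le :: "'a tree \<Rightarrow> 'a tree \<Rightarrow> bool" where
  "node_le (Node M ts) (Node M' ts') \<longleftrightarrow> M \<subseteq># M' \<and> (\<exists>ds. map fst ts' = map fst ts @ ds)"

definition ext :: "'a tree \<Rightarrow> 'a tree \<Rightarrow> bool" where
  "ext t t' \<longleftrightarrow> (\<forall>q u. subtree_at t q u \<longrightarrow> (\<exists>u'. subtree_at t' q u' \<and> node_le u u'))"

lemma node_le_refl [simp]: "node_le u u"
  by (cases u) simp

lemma node_le_trans: "node_le u v \<Longrightarrow> node_le v w \<Longrightarrow> node_le u w"
  by (cases u; cases v; cases w) auto

lemma node_le_labels:
  assumes "node_le u v" and "k < length (edge_labels u)"
  shows "k < length (edge_labels v)" and "edge_labels v ! k = edge_labels u ! k"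
proof -
  obtain ds where "edge_labels v = edge_labels u @ ds"
    using assms(1) by (cases u; cases v) auto
  then show "k < length (edge_labels v)" "edge_labels v ! k = edge_labels u ! k"
    using assms(2) by (simp_all add: nth_append)
qed

lemma ext_refl [simp]: "ext t t"
  unfolding ext_def using node_le_refl by blast

lemma ext_trans: "ext t u \<Longrightarrow> ext u v \<Longrightarrow> ext t v"
  unfolding ext_def by (meson node_le_trans)

lemma ext_nodes: "ext t t' \<Longrightarrow> nodes t \<subseteq> nodes t'"
  unfolding ext_def nodes_def by blast

lemma ext_prop_graph:
  assumes "ext t t'"
  shows "prop_graph t \<subseteq> prop_graph t'"
proof clarify
  fix p d q assume "(p, d, q) \<in> prop_graph t"
  then show "(p, d, q) \<in> prop_graph t'"
  proof (cases rule: prop_graph.cases)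
    case (down u k)
    with assms obtain u' where "subtree_at t' p u'" "node_le u u'"
      unfolding ext_def by blast
    with down node_le_labels[of u u' k] show ?thesis by (metis prop_graph.down)
  next
    case (up u k)
    with assms obtain u' where "subtree_at t' q u'" "node_le u u'"
      unfolding ext_def by blast
    with up node_le_labels[of u u' k] show ?thesis by (metis prop_graph.up)
  qed
qed

lemma ext_occ: "ext t t' \<Longrightarrow> occ t p A \<Longrightarrow> occ t' p A"
proof -
  assume "ext t t'" "occ t p A"
  then obtain M ts u where "subtree_at t' p u" "node_le (Node M ts) u" "A \<in># M"
    unfolding ext_def occ_def by blast
  then show "occ t' p A"
    unfolding occ_def by (cases u) (auto dest: mset_subset_eqD)
qed

lemma occ_nodes: "occ t p A \<Longrightarrow> p \<in> nodes t"
  unfolding occ_def nodes_def by blast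

lemma ext_grow: "ext (Node M ts) (Node (M + N) (ts @ cs))"
  unfolding ext_def
proof (intro allI impI)
  fix q u assume "subtree_at (Node M ts) q u"
  then show "\<exists>u'. subtree_at (Node (M + N) (ts @ cs)) q u' \<and> node_le u u'"
    by (cases q) (auto simp: nth_append intro: exI[of _ u])
qed

lemma ext_repl: "subtree_at t p u \<Longrightarrow> ext u v \<Longrightarrow> ext t (repl p v t)"
proof (induction rule: subtree_at.induct)
  case (child k ts p u M)
  show ?case
    unfolding ext_def
  proof (intro allI impI)
    fix q w assume w: "subtree_at (Node M ts) q w"
    show "\<exists>w'. subtree_at (repl (k # p) v (Node M ts)) q w' \<and> node_le w w'"
    proof (cases q)
      case Nil
      moreover have "(map fst ts)[k := fst (ts ! k)] = map fst ts"
        by (metis list_update_id map_update)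
      ultimately show ?thesis using w by (simp add: map_update)
    next
      case (Cons m r)
      with w child show ?thesis by (cases "m = k") (auto simp: ext_def intro: exI[of _ w])
    qed
  qed
qed simp

lemma ext_put:
  assumes "p \<in> nodes t"
  shows "ext t (put p A t)"
proof -
  from assms obtain M ts where u: "subtree_at t p (Node M ts)"
    by (rule nodesE)
  have "ext (Node M ts) (put [] A (Node M ts))"
    using ext_grow[of M ts "{#A#}" "[]"] by simp
  then show ?thesis
    unfolding put_eq_repl[OF u, of A] by (rule ext_repl[OF u])
qed

lemma occ_put:
  assumes "p \<in> nodes t"
  shows "occ (put p A t) p A"
proof -
  from assms obtain M ts where u: "subtree_at t p (Node M ts)"
    by (rule nodesE)
  have "subtree_at (put p A t) p (Node (M + {#A#}) ts)"
    using subtree_at_repl[OF u, of "Node (M + {#A#}) ts"] put_eq_repl[OF u, of A] by simp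
  then show ?thesis unfolding occ_def by (meson union_iff multi_member_last)
qed

text \<open>Removing one copy of \<open>A\<close> gives the tree to which it was added. This fits an
  occurrence to \<open>propagate\<close>, which is phrased with \<open>put\<close>.\<close>

lemma occ_imp_put: "occ t p A \<Longrightarrow> \<exists>t'. t = put p A t'"
proof -
  assume "occ t p A"
  then obtain M ts where u: "subtree_at t p (Node M ts)" and A: "A \<in># M"
    unfolding occ_def by blast
  have "t = put p A (repl p (Node (M - {#A#}) ts) t)"
    using u A by (induction t p "Node M ts" rule: subtree_at.induct) auto
  then show ?thesis by blast
qed

section \<open>Paths in labelled graphs\<close>

lemma graph_path_mono: "graph_path G i s j \<Longrightarrow> G \<subseteq> H \<Longrightarrow> graph_path H i s j"
  by (induction rule: graph_path.induct) (auto intro: graph_path.intros)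

lemma graph_path_append:
  "graph_path G i s j \<Longrightarrow> graph_path G j s' k \<Longrightarrow> graph_path G i (s @ s') k"
  by (induction rule: graph_path.induct) (auto intro: graph_path.intros)

lemma graph_path_rev:
  assumes "\<And>i l j. (i, l, j) \<in> G \<Longrightarrow> (j, dual_dir l, i) \<in> G"
  shows "graph_path G i s j \<Longrightarrow> graph_path G j (rev (map dual_dir s)) i"
proof (induction rule: graph_path.induct)
  case (step i l k s j)
  then show ?case
    using graph_path_append[OF step.IH] graph_path.step[OF assms graph_path.empty] by simp
qed (auto intro: graph_path.intros)

lemma graph_path_nodes: "graph_path (prop_graph t) p s q \<Longrightarrow> p \<in> nodes t \<Longrightarrow> q \<in> nodes t"
  by (induction rule: graph_path.induct) (auto dest: prop_graph_target)

section \<open>From DKt to SKt\<close>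

lemma residuation_iff:
  "SKt P (\<Gamma> + {#St d \<Delta>#}) \<longleftrightarrow> SKt P ({#St (dual_dir d) \<Gamma>#} + \<Delta>)"
proof
  assume "SKt P ({#St (dual_dir d) \<Gamma>#} + \<Delta>)"
  then have "SKt P (\<Delta> + {#St (dual_dir d) \<Gamma>#})" by (simp add: union_commute)
  from SKt.residuation[OF this] show "SKt P (\<Gamma> + {#St d \<Delta>#})" by (simp add: union_commute)
qed (rule SKt.residuation)

text \<open>Each level of the context is removed by one residuation, which turns the surroundings
  into a structure beside the hole. As \<open>\<Gamma>'\<close> does not depend on
  \<open>\<Delta>\<close>, a shallow rule can be applied and the context restored.\<close>

lemma display: "\<exists>\<Gamma>'. \<forall>\<Delta>. SKt P (\<Gamma> + fill S \<Delta>) \<longleftrightarrow> SKt P (\<Gamma>' + \<Delta>)"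
proof (induction S arbitrary: \<Gamma>)
  case (Hole \<Pi>)
  show ?case by (rule exI[of _ "\<Gamma> + \<Pi>"]) (simp add: union_assoc)
next
  case (Under \<Pi> d S)
  have "SKt P (\<Gamma> + fill (Under \<Pi> d S) \<Delta>) \<longleftrightarrow> SKt P ({#St (dual_dir d) (\<Gamma> + \<Pi>)#} + fill S \<Delta>)"
    for \<Delta>
    using residuation_iff[of P "\<Gamma> + \<Pi>" d "fill S \<Delta>"] by simp
  moreover obtain \<Gamma>' where
    "\<forall>\<Delta>. SKt P ({#St (dual_dir d) (\<Gamma> + \<Pi>)#} + fill S \<Delta>) \<longleftrightarrow> SKt P (\<Gamma>' + \<Delta>)"
    using Under by blast
  ultimately show ?case by blast
qed

lemma display_fill:
  obtains \<Gamma> where "\<And>\<Delta>. SKt P (fill S \<Delta>) \<longleftrightarrow> SKt P (\<Gamma> + \<Delta>)"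
  using display[of P "{#}" S] by auto

lemma SKt_fill_mono:
  assumes "\<And>\<Gamma>. SKt P (\<Gamma> + X) \<Longrightarrow> SKt P (\<Gamma> + Y)" and "SKt P (fill S X)"
  shows "SKt P (fill S Y)"
  by (rule display_fill[of P S]) (use assms in simp)

section \<open>Structural rules and diamond axioms for the completion\<close>

lemma nest_append: "nest (ds @ es) \<Delta> = nest ds (nest es \<Delta>)"
  by (induction ds) auto

lemma nest_fill: "\<exists>S. \<forall>\<Delta> :: 'a nseq. nest ds \<Delta> = fill S \<Delta>"
proof (induction ds)
  case Nil
  show ?case by (rule exI[of _ "Hole {#}"]) simp
next
  case (Cons d ds)
  then obtain S :: "'a ctx" where "\<forall>\<Delta>. nest ds \<Delta> = fill S \<Delta>" by blast
  then show ?case by (intro exI[of _ "Under {#} d S"]) simp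
qed

lemma display_nest:
  obtains \<Gamma>' where "\<And>\<Delta>. SKt P (\<Gamma> + nest ds \<Delta>) \<longleftrightarrow> SKt P (\<Gamma>' + \<Delta>)"
  using nest_fill[of ds] display[of P \<Gamma>] by metis

text \<open>Each residuation turns one edge around, so the chain comes out reversed with dual
  labels: the word of the inverted axiom.\<close>

lemma SKt_nest_residuation:
  "SKt P (\<Delta> + nest ds \<Gamma>) \<Longrightarrow> SKt P (\<Gamma> + nest (rev (map dual_dir ds)) \<Delta>)"
proof (induction ds arbitrary: \<Delta>)
  case Nil
  then show ?case by (simp add: union_commute)
next
  case (Cons d ds)
  have "SKt P ({#St (dual_dir d) \<Delta>#} + nest ds \<Gamma>)"
    by (rule SKt.residuation) (use Cons.prems in simp)
  from Cons.IH[OF this] show ?case by (simp add: nest_append)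
qed

text \<open>An inverted axiom is the original rule between residuations; a composition is the outer
  rule followed by the inner one at a displayed position.\<close>

lemma SKt_completion:
  "(ds, d) \<in> completion (P \<union> invert ` P) \<Longrightarrow> SKt P (\<Gamma> + {#St d \<Delta>#}) \<Longrightarrow> SKt P (\<Gamma> + nest ds \<Delta>)"
proof (induction ds d arbitrary: \<Gamma> \<Delta> rule: completion.induct[split_format(complete)])
  case (base ds d)
  show ?case
  proof (cases "(ds, d) \<in> P")
    case True
    then show ?thesis using base(2) by (rule SKt.path_rule)
  next
    case False
    then obtain es e where e: "(es, e) \<in> P" "ds = rev (map dual_dir es)" "d = dual_dir e"
      using base(1) by auto
    have "SKt P (\<Delta> + {#St e \<Gamma>#})"
      using SKt.residuation[OF base(2)] e(3) by (simp add: union_commute)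
    from SKt.path_rule[OF e(1) this] show ?thesis
      unfolding e(2) by (rule SKt_nest_residuation)
  qed
next
  case (ident d)
  then show ?case by simp
next
  case (compose fs f gs gs' g)
  obtain \<Gamma>' where \<Gamma>': "\<And>\<Delta>. SKt P (\<Gamma> + nest gs \<Delta>) \<longleftrightarrow> SKt P (\<Gamma>' + \<Delta>)"
    by (rule display_nest[of P \<Gamma> gs]) blast
  have "SKt P (\<Gamma> + nest gs {#St f (nest gs' \<Delta>)#})"
    using compose.IH(2)[OF compose.prems] by (simp add: nest_append)
  then have "SKt P (\<Gamma>' + nest fs (nest gs' \<Delta>))"
    unfolding \<Gamma>' by (rule compose.IH(1))
  then show ?case by (simp add: \<Gamma>' nest_append)
qed

text \<open>Weakening \<open>\<Delta>\<close> with the dual structure around the empty sequent gives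
  what one residuation turns into \<open>St d \<Delta>\<close>.\<close>

lemma SKt_necessitation: "SKt P \<Delta> \<Longrightarrow> SKt P {#St d \<Delta>#}"
  using residuation_iff[of P "{#}" d \<Delta>] SKt.wk[of P \<Delta> "{#St (dual_dir d) {#}#}"]
  by (simp add: union_commute)

lemma SKt_excluded_middle: "SKt P {#Fm A, Fm (neg A)#}"
proof -
  \<comment> \<open>Both auxiliary facts are stated for arbitrary pairs, since the induction meets a
    formula and its negation in either order.\<close>
  have modal: "SKt P {#Fm (Box d B), Fm (Dia d C)#}" if "SKt P {#Fm B, Fm C#}" for d B C
  proof -
    have "SKt P ({#} + {#St d ({#Fm B#} + {#Fm C#})#})"
      using SKt_necessitation[OF that] by (simp add: add_mset_commute)
    from SKt.dia[OF this] have "SKt P ({#Fm (Dia d C)#} + {#St d {#Fm B#}#})"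
      by (simp add: add_mset_commute)
    from SKt.box[OF this] show ?thesis by simp
  qed
  have binary: "SKt P {#Fm (And B C), Fm (Or B' C')#}"
    if "SKt P {#Fm B, Fm B'#}" "SKt P {#Fm C, Fm C'#}" for B B' C C'
  proof -
    have "SKt P ({#Fm B', Fm C'#} + {#Fm B#})" "SKt P ({#Fm B', Fm C'#} + {#Fm C#})"
      using SKt.wk[OF that(1), of "{#Fm C'#}"] SKt.wk[OF that(2), of "{#Fm B'#}"]
      by (simp_all add: add_mset_commute)
    from SKt.conj[OF this] have "SKt P ({#Fm (And B C)#} + {#Fm B', Fm C'#})"
      by (simp add: add_mset_commute)
    from SKt.disj[OF this] show ?thesis by (simp add: add_mset_commute)
  qed
  show ?thesis
  proof (induction A)
    case (Atom a)
    then show ?case using SKt.id[of P "{#}" a] by simp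
  next
    case (NAtom a)
    then show ?case using SKt.id[of P "{#}" a] by (simp add: add_mset_commute)
  next
    case (Or A B)
    then show ?case using binary[of "neg A" A "neg B" B] by (simp add: add_mset_commute)
  next
    case (And A B)
    then show ?case using binary by simp
  next
    case (Box d A)
    then show ?case using modal by simp
  next
    case (Dia d A)
    then show ?case using modal[of "neg A" A d] by (simp add: add_mset_commute)
  qed
qed

text \<open>The outermost edge is residuated away, the rest is boxed by induction, and after
  residuating back the structure holds a single formula, as \<open>box\<close> demands.\<close>

lemma SKt_nest_box:
  "SKt P (\<Gamma> + nest ds {#Fm A#}) \<Longrightarrow> SKt P (\<Gamma> + {#Fm (foldr Box ds A)#})"
proof (induction ds arbitrary: \<Gamma>)
  case (Cons d ds)
  have "SKt P ({#St (dual_dir d) \<Gamma>#} + nest ds {#Fm A#})"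
    by (rule SKt.residuation) (use Cons.prems in simp)
  from Cons.IH[OF this] have "SKt P (\<Gamma> + {#St d {#Fm (foldr Box ds A)#}#})"
    by (simp only: residuation_iff)
  from SKt.box[OF this] show ?case by simp
qed simp

lemma neg_foldr_Dia: "neg (foldr Dia ds A) = foldr Box ds (neg A)"
  by (induction ds) auto

text \<open>Beside \<open>Dia d A\<close>, the axiom lengthens \<open>St d {#Fm (neg A)#}\<close> to
  the chain \<open>ds\<close>. Boxing this chain gives the negation of the diamond chain, hence the
  second premise of a cut.\<close>

lemma SKt_path_dia:
  assumes "(ds, d) \<in> completion (P \<union> invert ` P)" and "SKt P (\<Gamma> + {#Fm (foldr Dia ds A)#})"
  shows "SKt P (\<Gamma> + {#Fm (Dia d A)#})"
proof -
  have "SKt P ({#} + {#St d ({#Fm (neg A)#} + {#Fm A#})#})"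
    using SKt_necessitation[OF SKt_excluded_middle] by (simp add: add_mset_commute)
  from SKt.dia[OF this] have "SKt P ({#Fm (Dia d A)#} + {#St d {#Fm (neg A)#}#})"
    by (simp add: add_mset_commute)
  from SKt_nest_box[OF SKt_completion[OF assms(1) this]]
  have "SKt P ({#Fm (Dia d A)#} + {#Fm (neg (foldr Dia ds A))#})"
    by (simp add: neg_foldr_Dia)
  from SKt.cut[OF assms(2) this] show ?thesis .
qed

section \<open>Simulating the rules of DKt\<close>

text \<open>Residuation makes the parent a child of its own child, so the shallow diamond rule also
  serves edges traversed upwards.\<close>

lemma SKt_dia_up:
  assumes "SKt P (\<Gamma> + {#St d \<Delta>, Fm A#})"
  shows "SKt P (\<Gamma> + {#St d (\<Delta> + {#Fm (Dia (dual_dir d) A)#})#})"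
proof -
  have "SKt P ((\<Gamma> + {#Fm A#}) + {#St d \<Delta>#})" using assms by simp
  from SKt.residuation[OF this] have "SKt P (\<Delta> + {#St (dual_dir d) (\<Gamma> + {#Fm A#})#})"
    by (simp add: union_commute)
  from SKt.dia[OF this]
  have "SKt P ((\<Delta> + {#Fm (Dia (dual_dir d) A)#}) + {#St (dual_dir d) \<Gamma>#})"
    by (simp add: add_mset_commute)
  from SKt.residuation[OF this] show ?thesis by (simp add: union_commute)
qed

lemma SKt_edge:
  assumes "(p, d, q) \<in> prop_graph t" and "SKt P (nseq_of (put q A t))"
  shows "SKt P (nseq_of (put p (Dia d A) t))"
  using assms(1)
proof (cases rule: prop_graph.cases)
  case (down u k)
  then obtain S \<Delta> where "\<And>A. nseq_of (put p A t) = fill S {#St d \<Delta>, Fm A#}"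
    and "\<And>A. nseq_of (put q A t) = fill S {#St d (\<Delta> + {#Fm A#})#}"
    using edge_fill[of t p u k] by blast
  then show ?thesis
    using assms(2) SKt_fill_mono[OF SKt.dia] by metis
next
  case (up u k)
  let ?e = "edge_labels u ! k"
  from up obtain S \<Delta> where "\<And>A. nseq_of (put q A t) = fill S {#St ?e \<Delta>, Fm A#}"
    and "\<And>A. nseq_of (put p A t) = fill S {#St ?e (\<Delta> + {#Fm A#})#}"
    using edge_fill[of t q u k] by blast
  then show ?thesis
    using assms(2) up(2) SKt_fill_mono[OF SKt_dia_up] by metis
qed

lemma SKt_path:
  "graph_path (prop_graph t) p s q \<Longrightarrow> SKt P (nseq_of (put q A t)) \<Longrightarrow>
    SKt P (nseq_of (put p (foldr Dia s A) t))"
  by (induction rule: graph_path.induct) (auto intro: SKt_edge)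

lemma SKt_ctr1: "SKt P (add_mset X (add_mset X \<Gamma>)) \<Longrightarrow> SKt P (add_mset X \<Gamma>)"
  using SKt.ctr[of P \<Gamma> "{#X#}"] by simp

text \<open>The premises repeat the principal formula, so each shallow rule at the displayed hole is
  followed by a contraction.\<close>

lemma DKt_imp_SKt: "DKt P \<Gamma> \<Longrightarrow> SKt P \<Gamma>"
proof (induction rule: DKt.induct)
  case (id S a)
  show ?case by (rule display_fill[of P S]) (simp only: SKt.id)
next
  case (conj S A B)
  obtain \<Gamma> where \<Gamma>: "\<And>\<Delta>. SKt P (fill S \<Delta>) \<longleftrightarrow> SKt P (\<Gamma> + \<Delta>)" by (rule display_fill[of P S]) blast
  have "SKt P ((\<Gamma> + {#Fm (And A B)#}) + {#Fm A#})" "SKt P ((\<Gamma> + {#Fm (And A B)#}) + {#Fm B#})"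
    using conj.IH by (simp_all add: \<Gamma> add_mset_commute)
  from SKt.conj[OF this] show ?case by (simp add: \<Gamma> SKt_ctr1)
next
  case (disj S A B)
  obtain \<Gamma> where \<Gamma>: "\<And>\<Delta>. SKt P (fill S \<Delta>) \<longleftrightarrow> SKt P (\<Gamma> + \<Delta>)" by (rule display_fill[of P S]) blast
  have "SKt P ((\<Gamma> + {#Fm (Or A B)#}) + {#Fm A, Fm B#})"
    using disj.IH by (simp add: \<Gamma> add_mset_commute)
  from SKt.disj[OF this] show ?case by (simp add: \<Gamma> SKt_ctr1)
next
  case (box S d A)
  obtain \<Gamma> where \<Gamma>: "\<And>\<Delta>. SKt P (fill S \<Delta>) \<longleftrightarrow> SKt P (\<Gamma> + \<Delta>)" by (rule display_fill[of P S]) blast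
  have "SKt P ((\<Gamma> + {#Fm (Box d A)#}) + {#St d {#Fm A#}#})"
    using box.IH by (simp add: \<Gamma> add_mset_commute)
  from SKt.box[OF this] show ?case by (simp add: \<Gamma> SKt_ctr1)
next
  case (dia1 S d \<Delta> A)
  obtain \<Gamma> where \<Gamma>: "\<And>\<Delta>. SKt P (fill S \<Delta>) \<longleftrightarrow> SKt P (\<Gamma> + \<Delta>)" by (rule display_fill[of P S]) blast
  have "SKt P ((\<Gamma> + {#Fm (Dia d A)#}) + {#St d (\<Delta> + {#Fm A#})#})"
    using dia1.IH by (simp add: \<Gamma> add_mset_commute)
  from SKt.dia[OF this]
  have "SKt P (add_mset (Fm (Dia d A)) (add_mset (Fm (Dia d A)) (\<Gamma> + {#St d \<Delta>#})))"
    by (simp add: add_mset_commute)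
  from SKt_ctr1[OF this] show ?case by (simp add: \<Gamma> add_mset_commute)
next
  case (dia2 S d \<Delta> A)
  obtain \<Gamma> where \<Gamma>: "\<And>\<Delta>. SKt P (fill S \<Delta>) \<longleftrightarrow> SKt P (\<Gamma> + \<Delta>)" by (rule display_fill[of P S]) blast
  let ?D = "Fm (Dia d A)"
  have "SKt P (\<Gamma> + {#St (dual_dir d) (\<Delta> + {#?D, ?D#})#})"
    using SKt_dia_up[of P \<Gamma> "dual_dir d"] dia2.IH by (simp add: \<Gamma>)
  \<comment> \<open>Both copies lie inside the structure, so its content is displayed before
    contracting.\<close>
  then have "SKt P (add_mset ?D (add_mset ?D ({#St d \<Gamma>#} + \<Delta>)))"
    using residuation_iff[of P \<Gamma> "dual_dir d"] by (simp add: add_mset_commute)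
  from SKt_ctr1[OF this] show ?case
    using residuation_iff[of P \<Gamma> "dual_dir d" "\<Delta> + {#?D#}"] by (simp add: \<Gamma>)
next
  case (propagate i t j s d A)
  \<comment> \<open>The tree \<open>?t\<close> keeps the principal diamond while \<open>A\<close>
    moves back to \<open>i\<close>; there the chain becomes a second copy of
    \<open>Dia d A\<close>.\<close>
  let ?D = "Dia d A" and ?t = "put i (Dia d A) t"
  have "graph_path (prop_graph ?t) i s j"
    using graph_path_mono[OF propagate(3) ext_prop_graph[OF ext_put[OF propagate(1)]]] .
  moreover have "SKt P (nseq_of (put j A ?t))"
    using propagate.IH by (simp add: put_commute)
  ultimately have "SKt P (nseq_of (put i (foldr Dia s A) ?t))"
    by (rule SKt_path)
  moreover obtain S where S: "\<And>A. nseq_of (put i A t) = fill S {#Fm A#}"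
    "\<And>A B. nseq_of (put i A (put i B t)) = fill S {#Fm A, Fm B#}"
    by (rule put_fill[OF propagate(1)]) blast
  moreover obtain \<Gamma> where \<Gamma>: "\<And>\<Delta>. SKt P (fill S \<Delta>) \<longleftrightarrow> SKt P (\<Gamma> + \<Delta>)"
    by (rule display_fill[of P S]) blast
  ultimately have "SKt P ((\<Gamma> + {#Fm ?D#}) + {#Fm (foldr Dia s A)#})"
    by (simp add: add_mset_commute)
  from SKt_path_dia[OF propagate(4) this] show ?case
    by (simp add: S \<Gamma> SKt_ctr1)
qed

section \<open>Soundness of SKt for Kripke models\<close>

primrec sat :: "(dir \<Rightarrow> 'w \<Rightarrow> 'w \<Rightarrow> bool) \<Rightarrow> ('a \<Rightarrow> 'w \<Rightarrow> bool) \<Rightarrow> 'a fm \<Rightarrow> 'w \<Rightarrow> bool" where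
  "sat R V (Atom a) = V a"
| "sat R V (NAtom a) = (\<lambda>w. \<not> V a w)"
| "sat R V (Or A B) = (\<lambda>w. sat R V A w \<or> sat R V B w)"
| "sat R V (And A B) = (\<lambda>w. sat R V A w \<and> sat R V B w)"
| "sat R V (Box d A) = (\<lambda>w. \<forall>v. R d w v \<longrightarrow> sat R V A v)"
| "sat R V (Dia d A) = (\<lambda>w. \<exists>v. R d w v \<and> sat R V A v)"

text \<open>A structure is read as a box over the disjunction of its content. Primitive recursion
  through a multiset calls for the image multiset; \<open>sat_elem_St\<close> gives the readable
  clause.\<close>

primrec sat_elem ::
  "(dir \<Rightarrow> 'w \<Rightarrow> 'w \<Rightarrow> bool) \<Rightarrow> ('a \<Rightarrow> 'w \<Rightarrow> bool) \<Rightarrow> 'a elem \<Rightarrow> 'w \<Rightarrow> bool" where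
  "sat_elem R V (Fm A) = sat R V A"
| "sat_elem R V (St d \<Delta>) =
    (\<lambda>w. \<forall>v. R d w v \<longrightarrow> (\<exists>f\<in>#image_mset (sat_elem R V) \<Delta>. f v))"

definition sat_nseq ::
  "(dir \<Rightarrow> 'w \<Rightarrow> 'w \<Rightarrow> bool) \<Rightarrow> ('a \<Rightarrow> 'w \<Rightarrow> bool) \<Rightarrow> 'a nseq \<Rightarrow> 'w \<Rightarrow> bool" where
  "sat_nseq R V \<Gamma> w \<longleftrightarrow> (\<exists>e\<in>#\<Gamma>. sat_elem R V e w)"

lemma sat_elem_St [simp]:
  "sat_elem R V (St d \<Delta>) w \<longleftrightarrow> (\<forall>v. R d w v \<longrightarrow> sat_nseq R V \<Delta> v)"
  by (simp add: sat_nseq_def)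

declare sat_elem.simps(2) [simp del]

lemma sat_nseq_simps [simp]:
  "\<not> sat_nseq R V {#} w"
  "sat_nseq R V (add_mset e \<Gamma>) w \<longleftrightarrow> sat_elem R V e w \<or> sat_nseq R V \<Gamma> w"
  "sat_nseq R V (\<Gamma> + \<Delta>) w \<longleftrightarrow> sat_nseq R V \<Gamma> w \<or> sat_nseq R V \<Delta> w"
  by (auto simp: sat_nseq_def)

lemma sat_neg [simp]: "sat R V (neg A) w \<longleftrightarrow> \<not> sat R V A w"
  by (induction A arbitrary: w) auto

text \<open>With \<open>R\<close> regarded as a labelled graph, \<open>graph_path\<close> expresses
  composite relations, and \<open>nest ds\<close> acts as a box over
  \<open>ds\<close>-paths.\<close>

lemma sat_nest:
  assumes "\<And>v. graph_path {(x, d, y). R d x y} w ds v \<Longrightarrow> sat_nseq R V \<Delta> v"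
  shows "sat_nseq R V (nest ds \<Delta>) w"
  using assms
proof (induction ds arbitrary: w)
  case Nil
  then show ?case by (simp add: graph_path.empty)
next
  case (Cons d ds)
  then show ?case by (auto intro!: Cons.IH Cons.prems graph_path.step)
qed

lemma SKt_sound:
  assumes conv: "\<And>d x y. R d x y \<Longrightarrow> R (dual_dir d) y x"
    and path: "\<And>ds d x y. (ds, d) \<in> P \<Longrightarrow> graph_path {(x, d, y). R d x y} x ds y \<Longrightarrow> R d x y"
    and "SKt P \<Gamma>"
  shows "sat_nseq R V \<Gamma> w"
  using assms(3)
proof (induction arbitrary: w rule: SKt.induct)
  case (cut \<Gamma> A \<Delta>)
  from cut.IH(1)[of w] cut.IH(2)[of w] show ?case by auto
next
  case (conj \<Gamma> A B)
  from conj.IH(1)[of w] conj.IH(2)[of w] show ?case by auto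
next
  case (residuation \<Gamma> d \<Delta>)
  \<comment> \<open>By \<open>conv\<close>, \<open>w\<close> is a \<open>d\<close>-successor of
    \<open>v\<close>, so failure of \<open>\<Delta>\<close> at \<open>w\<close> refutes
    \<open>St d \<Delta>\<close> at \<open>v\<close>.\<close>
  have "sat_nseq R V \<Gamma> v" if "\<not> sat_nseq R V \<Delta> w" "R (dual_dir d) w v" for v
    using that residuation.IH[of v] conv[OF that(2)] by auto
  then show ?case by auto
next
  case (dia \<Gamma> d \<Delta> A)
  from dia.IH[of w] show ?case by auto
next
  case (path_rule ds d \<Gamma> \<Delta>)
  show ?case
  proof (cases "sat_nseq R V \<Gamma> w")
    case False
    then have "sat_nseq R V \<Delta> v" if "R d w v" for v
      using path_rule.IH[of w] that by simp
    \<comment> \<open>By \<open>path\<close>, the end of a \<open>ds\<close>-path from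
      \<open>w\<close> is a \<open>d\<close>-successor of \<open>w\<close>.\<close>
    then have "sat_nseq R V (nest ds \<Delta>) w"
      by (intro sat_nest) (use path path_rule.hyps(1) in blast)
    then show ?thesis by simp
  qed simp
qed auto

section \<open>Countermodels from underivability in DKt\<close>

text \<open>
  The parameter \<open>q\<close> matters only for a diamond, where it is a node that the path has to reach;
  the path is taken in \<open>t\<close> while the witness is sought in the larger tree \<open>t'\<close>.
\<close>

fun fulfilled :: "path_axiom set \<Rightarrow> 'a tree \<Rightarrow> nat list \<Rightarrow> nat list \<Rightarrow> 'a fm \<Rightarrow> 'a tree \<Rightarrow> bool" where
  "fulfilled Q t p q (Or A B) t' \<longleftrightarrow> occ t' p A \<and> occ t' p B"
| "fulfilled Q t p q (And A B) t' \<longleftrightarrow> occ t' p A \<or> occ t' p B"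
| "fulfilled Q t p q (Box d A) t' \<longleftrightarrow> (\<exists>r. (p, d, r) \<in> prop_graph t' \<and> occ t' r A)"
| "fulfilled Q t p q (Dia d A) t' \<longleftrightarrow>
    ((\<exists>s. graph_path (prop_graph t) p s q \<and> (s, d) \<in> completion Q) \<longrightarrow> occ t' q A)"
| "fulfilled Q t p q _ t' \<longleftrightarrow> True"

text \<open>Paths are taken in the fixed tree \<open>t\<close>, so a demand is positive in the
  growing tree and stays met.\<close>

lemma fulfilled_mono: "fulfilled Q t p q A t' \<Longrightarrow> ext t' t'' \<Longrightarrow> fulfilled Q t p q A t''"
  using ext_occ[of t' t''] ext_prop_graph[of t' t''] by (cases A) auto

lemma occ_fill:
  assumes "occ t p A"
  obtains M ts S where "subtree_at t p (Node M ts)" "nseq_of t = fill S {#Fm A#}"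
    and "\<And>N cs. nseq_of (repl p (Node (M + N) (ts @ cs)) t) =
      fill S (add_mset (Fm A) (image_mset Fm N + nseq_children cs))"
proof -
  from assms obtain M ts where u: "subtree_at t p (Node M ts)" and A: "A \<in># M"
    unfolding occ_def by blast
  from A have M: "M = (M - {#A#}) + {#A#}" by simp
  show ?thesis
    by (rule node_fill[OF u M], rule that[OF u]) auto
qed

text \<open>A rule for \<open>A\<close> is read backwards: as its conclusion \<open>t'\<close> is
  underivable, some premise is too, and that premise serves as \<open>t''\<close>. Where nothing is
  demanded, \<open>t'\<close> itself serves.\<close>

lemma fulfil_one:
  fixes P :: "path_axiom set"
  defines "Q \<equiv> P \<union> invert ` P"
  assumes t': "\<not> DKt P (nseq_of t')" "ext t t'" and A: "occ t p A" and q: "q \<in> nodes t"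
  shows "\<exists>t''. ext t' t'' \<and> \<not> DKt P (nseq_of t'') \<and> fulfilled Q t p q A t''"
proof -
  from A t'(2) have occ: "occ t' p A" by (rule ext_occ[rotated])
  obtain M ts S where u: "subtree_at t' p (Node M ts)" and S: "nseq_of t' = fill S {#Fm A#}"
    and repl: "\<And>N cs. nseq_of (repl p (Node (M + N) (ts @ cs)) t') =
      fill S (add_mset (Fm A) (image_mset Fm N + nseq_children cs))"
    using occ by (rule occ_fill) blast
  let ?r = "\<lambda>N cs. repl p (Node (M + N) (ts @ cs)) t'"
  have ext: "ext t' (?r N cs)" for N cs
    by (rule ext_repl[OF u ext_grow])
  have r: "subtree_at (?r N cs) p (Node (M + N) (ts @ cs))" for N cs
    using u by (rule subtree_at_repl)
  have r_occ: "occ (?r N cs) p B" if "B \<in># N" for N cs B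
    unfolding occ_def using r[of N cs] that by fastforce
  show ?thesis
  proof (cases A)
    case (Atom a)
    then show ?thesis using t'(1) by (auto intro!: exI[of _ t'])
  next
    case (NAtom a)
    then show ?thesis using t'(1) by (auto intro!: exI[of _ t'])
  next
    case (Or B C)
    have "\<not> DKt P (nseq_of (?r {#B, C#} []))"
      using t'(1) DKt.disj[of P S B C] unfolding repl S Or by auto
    moreover have "fulfilled Q t p q A (?r {#B, C#} [])"
      unfolding Or by (simp only: fulfilled.simps) (intro conjI r_occ; simp)
    ultimately show ?thesis using ext by blast
  next
    case (And B C)
    have "\<not> DKt P (nseq_of (?r {#B#} [])) \<or> \<not> DKt P (nseq_of (?r {#C#} []))"
      using t'(1) DKt.conj[of P S B C] unfolding repl S And by auto
    moreover have "fulfilled Q t p q A (?r {#B#} [])" "fulfilled Q t p q A (?r {#C#} [])"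
      unfolding And using r_occ[of B "{#B#}" "[]"] r_occ[of C "{#C#}" "[]"] by simp_all
    ultimately show ?thesis using ext by blast
  next
    case (Box d B)
    \<comment> \<open>The child for \<open>B\<close> is appended, so its address is
      \<open>p @ [length ts]\<close>.\<close>
    let ?t = "?r {#} [(d, Node {#B#} [])]"
    have "\<not> DKt P (nseq_of ?t)"
      using t'(1) DKt.box[of P S d B] unfolding repl S Box by auto
    moreover have "(p, d, p @ [length ts]) \<in> prop_graph ?t"
      using prop_graph.down[OF r[of "{#}" "[(d, Node {#B#} [])]"], of "length ts"]
      by (simp add: nth_append)
    moreover have "occ ?t (p @ [length ts]) B"
      unfolding occ_def
      using subtree_at_append[OF r[of "{#}" "[(d, Node {#B#} [])]"], of "[length ts]" "Node {#B#} []"]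
      by fastforce
    ultimately show ?thesis using ext[of "{#}"] unfolding Box by auto
  next
    case (Dia d B)
    show ?thesis
    proof (cases "\<exists>s. graph_path (prop_graph t) p s q \<and> (s, d) \<in> completion Q")
      case True
      then obtain s where s: "graph_path (prop_graph t) p s q" "(s, d) \<in> completion Q" by blast
      obtain t0 where t0: "t' = put p (Dia d B) t0"
        using occ_imp_put occ Dia by blast
      have q': "q \<in> nodes t'" using q t'(2) ext_nodes by blast
      have "\<not> DKt P (nseq_of (put p (Dia d B) (put q B t0)))"
      proof (rule notI)
        assume "DKt P (nseq_of (put p (Dia d B) (put q B t0)))"
        moreover have "p \<in> nodes t0" "q \<in> nodes t0"
          using occ_nodes[OF occ] q' nodes_put unfolding t0 by blast+
        \<comment> \<open>The path persists in \<open>t'\<close> and lies in \<open>t0\<close>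
          already, since putting the diamond back adds no edge.\<close>
        moreover have "graph_path (prop_graph t0) p s q"
          using s(1) ext_prop_graph[OF t'(2)] prop_graph_put unfolding t0
          by (meson graph_path_mono order_trans)
        ultimately show False
          using t'(1) s(2) DKt.propagate[of p t0 q s d P B] unfolding t0 Q_def by blast
      qed
      then have "\<not> DKt P (nseq_of (put q B t'))" unfolding t0 by (simp add: put_commute)
      then show ?thesis using ext_put[OF q'] occ_put[OF q'] unfolding Dia by auto
    next
      case False
      then show ?thesis using t'(1) unfolding Dia by (intro exI[of _ t']) auto
    qed
  qed
qed

text \<open>Makes one round of proof search a finite iteration.\<close>

lemma finite_demands: "finite {(p, q, A). occ t p A \<and> q \<in> nodes t}"
proof -
  have "finite {A. occ t p A}" if p: "p \<in> nodes t" for p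
  proof -
    obtain M ts where u: "subtree_at t p (Node M ts)" using p by (rule nodesE)
    have "{A. occ t p A} \<subseteq> set_mset M"
      unfolding occ_def using subtree_at_fun[OF u] by auto
    then show ?thesis by (rule finite_subset) simp
  qed
  then have "finite (Sigma (nodes t) (\<lambda>p. nodes t \<times> {A. occ t p A}))"
    by (simp add: finite_nodes)
  then show ?thesis
    by (rule finite_subset[rotated]) (auto dest: occ_nodes)
qed

text \<open>The demands of \<open>t\<close> are met one after another, and
  \<open>fulfilled_mono\<close> keeps those already met. Nodes and formulae arising meanwhile wait
  for the next round.\<close>

lemma fulfil_all:
  fixes P :: "path_axiom set"
  assumes "\<not> DKt P (nseq_of t)"
  shows "\<exists>t'. ext t t' \<and> \<not> DKt P (nseq_of t') \<and>
    (\<forall>p q A. occ t p A \<longrightarrow> q \<in> nodes t \<longrightarrow> fulfilled (P \<union> invert ` P) t p q A t')"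
proof -
  let ?D = "{(p, q, A). occ t p A \<and> q \<in> nodes t}"
  have "\<exists>t'. ext t t' \<and> \<not> DKt P (nseq_of t') \<and>
    (\<forall>(p, q, A)\<in>F. fulfilled (P \<union> invert ` P) t p q A t')" if "finite F" "F \<subseteq> ?D" for F
    using that
  proof (induction F)
    case empty
    show ?case using assms ext_refl by blast
  next
    case (insert x F)
    obtain p q A where x: "x = (p, q, A)" by (cases x)
    from insert obtain t' where t': "ext t t'" "\<not> DKt P (nseq_of t')"
      "\<forall>(p, q, A)\<in>F. fulfilled (P \<union> invert ` P) t p q A t'" by auto
    obtain t'' where t'': "ext t' t''" "\<not> DKt P (nseq_of t'')"
      "fulfilled (P \<union> invert ` P) t p q A t''"
      using fulfil_one[OF t'(2,1), of p A q] insert.prems x by auto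
    have "\<forall>(p, q, A)\<in>insert x F. fulfilled (P \<union> invert ` P) t p q A t''"
      using t'(3) t''(3) fulfilled_mono[OF _ t''(1)] x by fast
    then show ?case using t'' ext_trans[OF t'(1) t''(1)] by blast
  qed
  from this[OF finite_demands] show ?thesis by fast
qed

section \<open>Closure of the completion and limits of paths\<close>

text \<open>Reversal sends a composition to the composition of the inverses at the mirrored
  position. This will make the two relations of the countermodel converse to each other.\<close>

lemma completion_invert:
  assumes "\<And>F. F \<in> Q \<Longrightarrow> invert F \<in> Q"
  shows "(s, d) \<in> completion Q \<Longrightarrow> (rev (map dual_dir s), dual_dir d) \<in> completion Q"
proof (induction s d rule: completion.induct[split_format(complete)])
  case (base s d)
  then show ?case using assms[of "(s, d)"] by (auto intro: completion.base)
next
  case (ident d)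
  then show ?case by (simp add: completion.ident)
next
  case (compose fs f gs gs' g)
  then show ?case using completion.compose[OF compose.IH(1), of "rev (map dual_dir gs')"] by simp
qed

text \<open>Each outer step stands for a word of the completion, and composition substitutes that
  word for the label of the step. The prefix \<open>es\<close> holds the labels already
  expanded.\<close>

lemma completion_graph_path:
  assumes "graph_path {(x, d, y). \<exists>s. graph_path G x s y \<and> (s, d) \<in> completion Q} x ds y"
    and "(es @ ds, d) \<in> completion Q"
  shows "\<exists>s. graph_path G x s y \<and> (es @ s, d) \<in> completion Q"
  using assms
proof (induction arbitrary: es rule: graph_path.induct)
  case (empty x)
  then show ?case using graph_path.empty by fastforce
next
  case (step x l z ds y)
  then obtain s where s: "graph_path G x s z" "(s, l) \<in> completion Q" by blast
  have "((es @ s) @ ds, d) \<in> completion Q"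
    using completion.compose[OF s(2), of es ds d] step.prems by simp
  from step.IH[OF this] obtain s' where "graph_path G z s' y" "((es @ s) @ s', d) \<in> completion Q"
    by blast
  then show ?case using graph_path_append[OF s(1)] by (metis append.assoc)
qed

text \<open>A path uses finitely many edges, and these all lie in one late enough stage.\<close>

lemma graph_path_Union:
  assumes "\<And>n. G n \<subseteq> G (Suc n)" and "graph_path (\<Union>n. G n) x s y"
  shows "\<exists>n. graph_path (G n) x s y"
  using assms(2)
proof (induction rule: graph_path.induct)
  case (empty x)
  then show ?case by (auto intro: graph_path.empty)
next
  case (step x l z s y)
  then obtain m n where "(x, l, z) \<in> G m" "graph_path (G n) z s y" by blast
  moreover have "G m \<subseteq> G (max m n)" "G n \<subseteq> G (max m n)"
    using lift_Suc_mono_le[of G, OF assms(1)] by simp_all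
  ultimately have "(x, l, z) \<in> G (max m n)" "graph_path (G (max m n)) z s y"
    by (auto intro: graph_path_mono)
  then show ?case by (blast intro: graph_path.step)
qed

text \<open>Worlds are addresses in the whole tree; the induction descends into a subtree rooted at
  \<open>r\<close>, whose local address \<open>p\<close> is the world \<open>r @ p\<close>.\<close>

lemma not_sat_nseq:
  assumes "\<And>p A. occ t p A \<Longrightarrow> \<not> sat R V A (r @ p)"
    and "\<And>p d q. (p, d, q) \<in> prop_graph t \<Longrightarrow> R d (r @ p) (r @ q)"
  shows "\<not> sat_nseq R V (nseq_of t) r"
  using assms
proof (induction t arbitrary: r)
  case (Node M ts)
  have "\<not> sat R V A r" if "A \<in># M" for A
    using Node.prems(1)[of "[]" A] that by (auto simp: occ_def)
  moreover have "\<not> sat_elem R V (St d (nseq_of u)) r" if du: "(d, u) \<in> set ts" for d u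
  proof -
    obtain k where k: "k < length ts" "ts ! k = (d, u)"
      using du by (auto simp: in_set_conv_nth)
    have "([], d, [k]) \<in> prop_graph (Node M ts)"
      using prop_graph.down[of "Node M ts" "[]" "Node M ts" k] k by simp
    then have "R d r (r @ [k])" using Node.prems(2)[of "[]" d "[k]"] by simp
    moreover have "\<not> sat_nseq R V (nseq_of u) (r @ [k])"
    proof (rule Node.IH[of "(d, u)" u])
      show "(d, u) \<in> set ts" "u \<in> Basic_BNFs.snds (d, u)" using du by simp_all
      have *: "subtree_at (Node M ts) (k # p) v" if "subtree_at u p v" for p v
        using that k by simp
      show "\<not> sat R V A ((r @ [k]) @ p)" if "occ u p A" for p A
        using Node.prems(1)[of "k # p" A] that * by (auto simp: occ_def)
      show "R e ((r @ [k]) @ p) ((r @ [k]) @ q)" if "(p, e, q) \<in> prop_graph u" for p e q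
      proof -
        have "(k # p, e, k # q) \<in> prop_graph (Node M ts)"
          using that
        proof (cases rule: prop_graph.cases)
          case (down v m)
          then show ?thesis using prop_graph.down[OF *, of p v m] by simp
        next
          case (up v m)
          then show ?thesis using prop_graph.up[OF *, of q v m] by simp
        qed
        from Node.prems(2)[OF this] show ?thesis by simp
      qed
    qed
    ultimately show ?thesis by auto
  qed
  ultimately show ?case
    by (auto simp: sat_nseq_def simp del: sat_elem_St)
qed

section \<open>The countermodel of a failed proof search\<close>

lemma DKt_countermodel:
  fixes P :: "path_axiom set" and \<Gamma> :: "'a nseq"
  assumes "\<not> DKt P \<Gamma>"
  obtains R :: "dir \<Rightarrow> nat list \<Rightarrow> nat list \<Rightarrow> bool" and V :: "'a \<Rightarrow> nat list \<Rightarrow> bool"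
  where "\<And>d x y. R d x y \<Longrightarrow> R (dual_dir d) y x"
    and "\<And>ds d x y. (ds, d) \<in> P \<Longrightarrow> graph_path {(x, d, y). R d x y} x ds y \<Longrightarrow> R d x y"
    and "\<not> sat_nseq R V \<Gamma> []"
proof -
  let ?Q = "P \<union> invert ` P"
  obtain t0 where t0: "nseq_of t0 = \<Gamma>" using ex_tree by blast
  \<comment> \<open>Proof search as dependent choice; the clause on \<open>n = 0\<close> in the
    invariant fixes the first tree.\<close>
  have "\<exists>t. \<forall>n :: nat. (\<not> DKt P (nseq_of (t n)) \<and> (n = 0 \<longrightarrow> t n = t0)) \<and>
    (ext (t n) (t (Suc n)) \<and>
      (\<forall>p q A. occ (t n) p A \<longrightarrow> q \<in> nodes (t n) \<longrightarrow> fulfilled ?Q (t n) p q A (t (Suc n))))"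
  proof (rule dependent_nat_choice)
    show "\<exists>t. \<not> DKt P (nseq_of t) \<and> ((0 :: nat) = 0 \<longrightarrow> t = t0)"
      using assms t0 by auto
  next
    fix t and n :: nat assume "\<not> DKt P (nseq_of t) \<and> (n = 0 \<longrightarrow> t = t0)"
    then show "\<exists>t'. (\<not> DKt P (nseq_of t') \<and> (Suc n = 0 \<longrightarrow> t' = t0)) \<and> ext t t' \<and>
      (\<forall>p q A. occ t p A \<longrightarrow> q \<in> nodes t \<longrightarrow> fulfilled ?Q t p q A t')"
      using fulfil_all[of P t] by auto
  qed
  then obtain t where underivable: "\<And>n. \<not> DKt P (nseq_of (t n))" and t_0: "t 0 = t0"
    and ext_Suc: "\<And>n. ext (t n) (t (Suc n))"
    and fulfil: "\<And>n p q A. occ (t n) p A \<Longrightarrow> q \<in> nodes (t n) \<Longrightarrow>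
      fulfilled ?Q (t n) p q A (t (Suc n))"
    by blast
  have ext_le: "ext (t m) (t n)" if "m \<le> n" for m n
    using that by (induction rule: dec_induct) (auto intro: ext_trans ext_Suc)
  define G where "G = (\<Union>n. prop_graph (t n))"
  define R where "R d x y \<longleftrightarrow> (\<exists>s. graph_path G x s y \<and> (s, d) \<in> completion ?Q)" for d x y
  \<comment> \<open>An atom is true just where its negation occurs at some stage. This refutes each
    occurring \<open>NAtom a\<close> at once and leaves \<open>Atom a\<close> to the rule
    \<open>id\<close>.\<close>
  define V where "V a x \<longleftrightarrow> (\<exists>n. occ (t n) x (NAtom a))" for a x
  have edge: "R d x y" if "(x, d, y) \<in> prop_graph (t n)" for d x y n
  proof -
    have "graph_path G x [d] y"
      using that by (auto simp: G_def intro!: graph_path.intros)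
    then show ?thesis unfolding R_def using completion.ident by blast
  qed
  have conv: "R (dual_dir d) y x" if "R d x y" for d x y
  proof -
    from that obtain s where s: "graph_path G x s y" "(s, d) \<in> completion ?Q"
      unfolding R_def by blast
    have "invert (invert F) = F" for F
      by (cases F) (simp add: rev_map comp_def)
    then have "invert F \<in> ?Q" if "F \<in> ?Q" for F
      using that by auto
    then have "(rev (map dual_dir s), dual_dir d) \<in> completion ?Q"
      using completion_invert s(2) by blast
    moreover have "graph_path G y (rev (map dual_dir s)) x"
      using s(1) by (rule graph_path_rev[rotated]) (auto simp: G_def dest: prop_graph_sym)
    ultimately show ?thesis unfolding R_def by blast
  qed
  \<comment> \<open>With empty prefix, the word to be expanded is that of the axiom itself.\<close>
  have path: "R d x y" if "(ds, d) \<in> P" "graph_path {(x, d, y). R d x y} x ds y" for ds d x y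
    using completion_graph_path[of G ?Q x ds y "[]" d] that
    unfolding R_def by (auto intro: completion.base)
  \<comment> \<open>All stages and nodes are treated at once, as subformulae turn up later and
    elsewhere.\<close>
  have truth: "\<not> sat R V A p" if "occ (t n) p A" for n p A
    using that
  proof (induction A arbitrary: n p)
    case (Atom a)
    have False if "occ (t m) p (NAtom a)" for m
    proof -
      \<comment> \<open>Occurrences persist, so a common stage has both literals at \<open>p\<close>
        and would be an instance of \<open>id\<close>.\<close>
      let ?n = "max m n"
      have a: "occ (t ?n) p (Atom a)" and na: "occ (t ?n) p (NAtom a)"
        using Atom that ext_occ[OF ext_le[of _ ?n]] by (meson max.cobounded1 max.cobounded2)+
      obtain M ts where u: "subtree_at (t ?n) p (Node M ts)" and M: "Atom a \<in># M"
        using a unfolding occ_def by blast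
      have "NAtom a \<in># M"
        using na subtree_at_fun[OF u] unfolding occ_def by auto
      moreover obtain M1 where M1: "M = add_mset (Atom a) M1"
        using M by (blast dest: multi_member_split)
      ultimately obtain M2 where "M1 = add_mset (NAtom a) M2"
        by (auto dest: multi_member_split)
      with M1 have "M = M2 + {#Atom a, NAtom a#}" by simp
      then obtain S where "nseq_of (t ?n) = fill S (image_mset Fm {#Atom a, NAtom a#})"
        by (rule node_fill[OF u]) blast
      then show False using underivable[of ?n] DKt.id[of P S a] by simp
    qed
    then show ?case by (auto simp: V_def)
  next
    case (NAtom a)
    then show ?case by (auto simp: V_def)
  next
    case (Or A B)
    then show ?case using fulfil[OF Or.prems occ_nodes[OF Or.prems]] by auto
  next
    case (And A B)
    then show ?case using fulfil[OF And.prems occ_nodes[OF And.prems]] by auto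
  next
    case (Box d A)
    obtain q where "(p, d, q) \<in> prop_graph (t (Suc n))" "occ (t (Suc n)) q A"
      using fulfil[OF Box.prems occ_nodes[OF Box.prems]] by auto
    then have "R d p q" "\<not> sat R V A q" using edge Box.IH by blast+
    then show ?case by auto
  next
    case (Dia d A)
    have "\<not> sat R V A q" if "R d p q" for q
    proof -
      from that obtain s where s: "graph_path G p s q" "(s, d) \<in> completion ?Q"
        unfolding R_def by blast
      have "\<exists>m. graph_path (prop_graph (t m)) p s q"
        using s(1) unfolding G_def
        by (rule graph_path_Union[rotated]) (rule ext_prop_graph[OF ext_Suc])
      then obtain m where m: "graph_path (prop_graph (t m)) p s q" by blast
      \<comment> \<open>At this stage both the diamond and the whole path are present, so the next
        stage has \<open>A\<close> at \<open>q\<close>.\<close>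
      let ?n = "max m n"
      have "ext (t m) (t ?n)" "ext (t n) (t ?n)" by (simp_all add: ext_le)
      then have p: "occ (t ?n) p (Dia d A)" and path: "graph_path (prop_graph (t ?n)) p s q"
        using Dia.prems ext_occ graph_path_mono[OF m ext_prop_graph] by blast+
      from fulfil[OF p graph_path_nodes[OF path occ_nodes[OF p]]] path s(2)
      have "occ (t (Suc ?n)) q A" by auto
      then show ?thesis by (rule Dia.IH)
    qed
    then show ?case by auto
  qed
  have "\<not> sat_nseq R V (nseq_of t0) []"
    by (rule not_sat_nseq) (use truth[of 0] edge[of _ _ _ 0] t_0 in auto)
  with conv path show ?thesis using that t0 by blast
qed

theorem theorem6p15:
  fixes P :: "path_axiom set" and \<Gamma> :: "'a nseq"
  shows "SKt P \<Gamma> \<longleftrightarrow> DKt P \<Gamma>"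
proof
  assume "SKt P \<Gamma>"
  show "DKt P \<Gamma>"
  proof (rule ccontr)
    assume "\<not> DKt P \<Gamma>"
    then show False
    proof (rule DKt_countermodel)
      fix R :: "dir \<Rightarrow> nat list \<Rightarrow> nat list \<Rightarrow> bool" and V :: "'a \<Rightarrow> nat list \<Rightarrow> bool"
      assume conv: "\<And>d x y. R d x y \<Longrightarrow> R (dual_dir d) y x"
        and path: "\<And>ds d x y. (ds, d) \<in> P \<Longrightarrow> graph_path {(x, d, y). R d x y} x ds y \<Longrightarrow> R d x y"
        and false: "\<not> sat_nseq R V \<Gamma> []"
      have "sat_nseq R V \<Gamma> []"
        using conv path \<open>SKt P \<Gamma>\<close> by (rule SKt_sound)
      with false show False ..
    qed
  qed
qed (rule DKt_imp_SKt)

end
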